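(* Let $X$ be a separable reflexive Banach space and let $1<p,q<\infty$ with $1/p+1/q=1$. Let $K>0$. A sequence $\{f_n\}_{n=1}^\infty\subset X$ is a $(C_q)$-system in $X$ with constant $K$ if and only if $$\frac{1}{K}\|h\|\le\Big(\sum_{n=1}^\infty|\langle h,f_n\rangle|^p\Big)^{1/p}\quad\text{for all } h\in X^*.$$
   Context: $(C_q)$-system with constant $C>0$: a sequence $\{f_n\}_{n=1}^\infty$ in a separable reflexive Banach space $X$ is a $(C_q)$-system in $X$ with constant $C$ if for every $f\in X$ and every $\varepsilon>0$ there is a finite linear combination $g=\sum a_nf_n$ with $\|f-g\|_X<\varepsilon$ and $(\sum|a_n|^q)^{1/q}\le C\|f\|_X$ ($C$ not depending on $f$ or $\varepsilon$). The series on the right-hand side of the inequality is allowed to take the value $+\infty$. $\langle h,f\rangle$ denotes the duality pairing of $h\in X^*$ with $f\in X$. *)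

theory Defs
  imports "HOL-Analysis.Analysis"
begin

text \<open>
  A Banach space may be real or complex. Both cases are covered by letting the scalars
  range over normed fields that are isometrically isomorphic to the reals or to the
  complex numbers.
\<close>

class real_or_complex = real_normed_field +
  assumes iso_real_or_complex:
    "(\<exists>\<phi> :: 'a \<Rightarrow> real. bij \<phi> \<and> (\<forall>x y. \<phi> (x + y) = \<phi> x + \<phi> y) \<and>
        (\<forall>r x. \<phi> (r *\<^sub>R x) = r *\<^sub>R \<phi> x) \<and>
        (\<forall>x y. \<phi> (x * y) = \<phi> x * \<phi> y) \<and> (\<forall>x. norm (\<phi> x) = norm x)) \<or>
     (\<exists>\<phi> :: 'a \<Rightarrow> complex. bij \<phi> \<and> (\<forall>x y. \<phi> (x + y) = \<phi> x + \<phi> y) \<and>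
        (\<forall>r x. \<phi> (r *\<^sub>R x) = r *\<^sub>R \<phi> x) \<and>
        (\<forall>x y. \<phi> (x * y) = \<phi> x * \<phi> y) \<and> (\<forall>x. norm (\<phi> x) = norm x))"

instance real :: real_or_complex
  by standard (rule disjI1, rule exI[of _ id], simp)

instance complex :: real_or_complex
  by standard (rule disjI2, rule exI[of _ id], simp)

text \<open>
  The locale equips the type of vectors with a multiplication by such scalars for which
  its norm is homogeneous and which extends the multiplication by reals that the type
  class already provides. The latter costs no generality, since a normed space over
  either field is in particular a real normed space.
\<close>

locale normed_scaling = vector_space smul
  for smul :: "'k::real_or_complex \<Rightarrow> 'a::real_normed_vector \<Rightarrow> 'a" +
  assumes smul_of_real: "smul (of_real r) x = r *\<^sub>R x"
    and norm_smul: "norm (smul c x) = norm c * norm x"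

lemma normed_scaling_scaleR: "normed_scaling (scaleR :: real \<Rightarrow> 'a::real_normed_vector \<Rightarrow> 'a)"
  by unfold_locales (auto simp: algebra_simps)

lemma normed_scaling_mult: "normed_scaling ((*) :: 'k::real_or_complex \<Rightarrow> 'k \<Rightarrow> 'k)"
  by unfold_locales (auto simp: algebra_simps norm_mult scaleR_conv_of_real)

text \<open>
  Bounded linear functions in the library are linear over the reals only; the dual space
  consists of those that are linear over the scalar field. The library's operator norm is
  the dual norm.
\<close>

definition dual_space ::
    "('k::real_or_complex \<Rightarrow> 'a::real_normed_vector \<Rightarrow> 'a) \<Rightarrow> ('a \<Rightarrow>\<^sub>L 'k) set" where
  "dual_space smul = {h :: 'a \<Rightarrow>\<^sub>L 'k. \<forall>c x. h (smul c x) = c * h x}"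

lemma dual_space_scaleR: "dual_space scaleR = (UNIV :: ('a::real_normed_vector \<Rightarrow>\<^sub>L real) set)"
  by (auto simp: dual_space_def blinfun.scaleR_right)

text \<open>
  Every bounded linear functional \<open>\<Phi>\<close> on the dual space is the evaluation at a point.
  Here \<open>blinfun_mult_right c o\<^sub>L h\<close> is the scalar multiple of \<open>h\<close> by \<open>c\<close>.
\<close>

definition reflexive_space ::
    "('k::real_or_complex \<Rightarrow> 'a::real_normed_vector \<Rightarrow> 'a) \<Rightarrow> bool" where
  "reflexive_space smul \<longleftrightarrow>
     (\<forall>\<Phi> :: ('a \<Rightarrow>\<^sub>L 'k) \<Rightarrow> 'k.
        (\<forall>h\<in>dual_space smul. \<forall>k\<in>dual_space smul. \<Phi> (h + k) = \<Phi> h + \<Phi> k) \<and>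
        (\<forall>c. \<forall>h\<in>dual_space smul. \<Phi> (blinfun_mult_right c o\<^sub>L h) = c * \<Phi> h) \<and>
        (\<exists>B. \<forall>h\<in>dual_space smul. norm (\<Phi> h) \<le> B * norm h) \<longrightarrow>
        (\<exists>x. \<forall>h\<in>dual_space smul. \<Phi> h = h x))"

text \<open>Sequences are indexed from \<open>0\<close>.\<close>

definition Cq_system ::
    "('k::real_or_complex \<Rightarrow> 'a::real_normed_vector \<Rightarrow> 'a) \<Rightarrow> real \<Rightarrow> real \<Rightarrow> (nat \<Rightarrow> 'a) \<Rightarrow> bool" where
  "Cq_system smul q C f \<longleftrightarrow>
     (\<forall>x. \<forall>\<epsilon>>0. \<exists>(A :: nat set) (a :: nat \<Rightarrow> 'k). finite A \<and>
        norm (x - (\<Sum>n\<in>A. smul (a n) (f n))) < \<epsilon> \<and>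
        (\<Sum>n\<in>A. norm (a n) powr q) powr (1 / q) \<le> C * norm x)"

text \<open>\<open>(\<Sum>n. |a n|\<^sup>p)\<^bsup>1/p\<^esup>\<close>, which is infinite if the series diverges.\<close>

definition lp_norm :: "real \<Rightarrow> (nat \<Rightarrow> 'k::real_normed_vector) \<Rightarrow> ennreal" where
  "lp_norm p a =
     (let s = \<Sum>n. ennreal (norm (a n) powr p)
      in if s = \<infinity> then \<infinity> else ennreal (enn2real s powr (1 / p)))"

end

theory Submission
  imports Defs
begin

text \<open>
  Both directions are duality between \<open>\<ell>\<^sup>q\<close> and \<open>\<ell>\<^sup>p\<close>. If \<open>f\<close> is a system with constant \<open>K\<close>, then
  evaluating \<open>h\<close> at an approximant \<open>\<Sum> a n f n\<close> of \<open>x\<close> and applying Hoelder's inequality gives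
  \<open>|h x| \<le> K \<parallel>x\<parallel> \<parallel>(h (f n))\<^sub>n\<parallel>\<^sub>p\<close> up to an arbitrarily small error
  (\<open>lower_bound_if_Cq_system\<close>).

  For the converse consider, for \<open>d > 0\<close>, the seminorm
  \<open>N y = inf (\<parallel>a\<parallel>\<^sub>q + \<parallel>y - \<Sum> a n f n\<parallel> / d)\<close> over finitely supported \<open>a\<close>. By the Hahn--Banach theorem
  there is a scalar-linear \<open>h\<close> with \<open>|h| \<le> N\<close> everywhere and \<open>|h x| = N x\<close>. It is continuous because
  \<open>N y \<le> \<parallel>y\<parallel> / d\<close>. Since \<open>N (\<Sum> a n f n) \<le> \<parallel>a\<parallel>\<^sub>q\<close>, the converse of Hoelder's inequality yields
  \<open>\<parallel>(h (f n))\<^sub>n\<parallel>\<^sub>p \<le> 1\<close>, and the assumed lower bound then says \<open>\<parallel>h\<parallel> \<le> K\<close>. Hence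
  \<open>N x = |h x| \<le> K \<parallel>x\<parallel>\<close> for every \<open>d\<close> (\<open>approx_cost_le_norm\<close>). So \<open>x\<close> has approximants with
  \<open>\<parallel>a\<parallel>\<^sub>q\<close> as close to \<open>K \<parallel>x\<parallel>\<close> as desired and with error at most about \<open>d K \<parallel>x\<parallel>\<close>, which is small when
  \<open>d\<close> is; shrinking \<open>x\<close> slightly makes the bound on \<open>\<parallel>a\<parallel>\<^sub>q\<close> exact (\<open>Cq_system_if_lower_bound\<close>).

  The Hahn--Banach theorem is obtained from sublinear functionals alone, without partially defined
  extensions: a minimal sublinear functional is linear, and Zorn's lemma provides minimal ones.
\<close>

section \<open>Sublinear functionals and the Hahn--Banach theorem\<close>

text \<open>
  Homogeneity is only demanded as an inequality, which is what infima of such functionals inherit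
  at once; equality follows.
\<close>

definition sublinear :: "('v::real_vector \<Rightarrow> real) \<Rightarrow> bool" where
  "sublinear p \<longleftrightarrow> (\<forall>x y. p (x + y) \<le> p x + p y) \<and> (\<forall>t x. 0 \<le> t \<longrightarrow> p (t *\<^sub>R x) \<le> t * p x)"

lemma sublinear_add: "sublinear p \<Longrightarrow> p (x + y) \<le> p x + p y"
  by (simp add: sublinear_def)

lemma sublinear_scale_le: "sublinear p \<Longrightarrow> 0 \<le> t \<Longrightarrow> p (t *\<^sub>R x) \<le> t * p x"
  by (simp add: sublinear_def)

lemma sublinear_zero:
  assumes "sublinear p" shows "p 0 = 0"
  using sublinear_add[OF assms, of 0 0] sublinear_scale_le[OF assms, of 0 0] by simp

lemma sublinear_scale:
  assumes p: "sublinear p" and t: "0 \<le> t"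
  shows "p (t *\<^sub>R x) = t * p x"
proof (cases "t = 0")
  case False
  with t have t: "0 < t" by simp
  have "p ((1 / t) *\<^sub>R (t *\<^sub>R x)) \<le> (1 / t) * p (t *\<^sub>R x)"
    using t by (intro sublinear_scale_le[OF p]) simp
  with t have "t * p x \<le> p (t *\<^sub>R x)" by (simp add: field_simps)
  then show ?thesis
    using sublinear_scale_le[OF p, of t x] t by simp
qed (simp add: sublinear_zero[OF p])

lemma sublinear_minus:
  assumes "sublinear p" shows "- p (- x) \<le> p x"
  using sublinear_add[OF assms, of x "- x"] sublinear_zero[OF assms] by simp

text \<open>
  The largest sublinear functional below \<open>p\<close> that takes the value \<open>- p y\<close> at \<open>- y\<close>, and so is
  additive along the line through \<open>y\<close>.
\<close>

definition straighten :: "('v::real_vector \<Rightarrow> real) \<Rightarrow> 'v \<Rightarrow> 'v \<Rightarrow> real" where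
  "straighten p y x = (INF t\<in>{0..}. p (x + t *\<^sub>R y) - t * p y)"

lemma straighten_le:
  assumes p: "sublinear p" and t: "0 \<le> t"
  shows "straighten p y x \<le> p (x + t *\<^sub>R y) - t * p y"
  unfolding straighten_def
proof (rule cINF_lower)
  show "bdd_below ((\<lambda>t. p (x + t *\<^sub>R y) - t * p y) ` {0..})"
  proof (rule bdd_belowI2)
    fix s :: real assume "s \<in> {0..}"
    then have "s * p y \<le> p (x + s *\<^sub>R y) + p (- x)"
      using sublinear_add[OF p, of "x + s *\<^sub>R y" "- x"] sublinear_scale[OF p, of s y] by simp
    then show "- p (- x) \<le> p (x + s *\<^sub>R y) - s * p y" by simp
  qed
qed (use t in simp)

lemma straighten_ge:
  "(\<And>t. 0 \<le> t \<Longrightarrow> b \<le> p (x + t *\<^sub>R y) - t * p y) \<Longrightarrow> b \<le> straighten p y x"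
  unfolding straighten_def by (rule cINF_greatest) auto

lemma straighten_le_self: "sublinear p \<Longrightarrow> straighten p y x \<le> p x"
  using straighten_le[of p 0 y x] by simp

lemma sublinear_straighten:
  assumes p: "sublinear p"
  shows "sublinear (straighten p y)"
  unfolding sublinear_def
proof (intro conjI allI impI)
  fix u v
  have *: "straighten p y (u + v) \<le> (p (u + s *\<^sub>R y) - s * p y) + (p (v + t *\<^sub>R y) - t * p y)"
    if "0 \<le> s" "0 \<le> t" for s t
  proof -
    have "u + v + (s + t) *\<^sub>R y = (u + s *\<^sub>R y) + (v + t *\<^sub>R y)"
      by (simp add: algebra_simps)
    then show ?thesis
      using straighten_le[OF p, of "s + t" y "u + v"] that
        sublinear_add[OF p, of "u + s *\<^sub>R y" "v + t *\<^sub>R y"] by (simp add: algebra_simps)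
  qed
  have "straighten p y (u + v) - (p (u + s *\<^sub>R y) - s * p y) \<le> straighten p y v" if "0 \<le> s" for s
    by (rule straighten_ge) (use *[OF that] in \<open>simp add: algebra_simps\<close>)
  then have "straighten p y (u + v) - straighten p y v \<le> straighten p y u"
    by (intro straighten_ge) (simp add: algebra_simps)
  then show "straighten p y (u + v) \<le> straighten p y u + straighten p y v" by simp
next
  fix c :: real and x assume "0 \<le> c"
  show "straighten p y (c *\<^sub>R x) \<le> c * straighten p y x"
  proof (cases "c = 0")
    case True
    then show ?thesis using straighten_le_self[OF p, of y 0] sublinear_zero[OF p] by simp
  next
    case False
    with \<open>0 \<le> c\<close> have c: "0 < c" by simp
    have "straighten p y (c *\<^sub>R x) / c \<le> straighten p y x"
    proof (rule straighten_ge)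
      fix t :: real assume t: "0 \<le> t"
      have "straighten p y (c *\<^sub>R x) \<le> p (c *\<^sub>R (x + t *\<^sub>R y)) - c * t * p y"
        using straighten_le[OF p, of "c * t" y "c *\<^sub>R x"] t c by (simp add: algebra_simps)
      then show "straighten p y (c *\<^sub>R x) / c \<le> p (x + t *\<^sub>R y) - t * p y"
        using c sublinear_scale[OF p, of c "x + t *\<^sub>R y"] by (simp add: field_simps)
    qed
    then show ?thesis using c by (simp add: field_simps)
  qed
qed

text \<open>
  The bound \<open>- p (- x)\<close> keeps the infimum finite. For subadditivity two members of the chain are
  replaced by the smaller one.
\<close>

lemma sublinear_chain_INF:
  fixes p :: "'v::real_vector \<Rightarrow> real"
  assumes p: "sublinear p" and ne: "C \<noteq> {}"
    and C: "\<And>r. r \<in> C \<Longrightarrow> sublinear r \<and> r \<le> p"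
    and total: "\<And>r s. r \<in> C \<Longrightarrow> s \<in> C \<Longrightarrow> r \<le> s \<or> s \<le> r"
  shows "sublinear (\<lambda>x. INF r\<in>C. r x)" and "\<And>r x. r \<in> C \<Longrightarrow> (INF r\<in>C. r x) \<le> r x"
proof -
  define m where "m x = (INF r\<in>C. r x)" for x
  have lower: "m x \<le> r x" if "r \<in> C" for r x
    unfolding m_def
  proof (rule cINF_lower[OF bdd_belowI2 that])
    fix s assume s: "s \<in> C"
    then have "s (- x) \<le> p (- x)" using C by (simp add: le_fun_def)
    then show "- p (- x) \<le> s x" using sublinear_minus[of s x] C s by force
  qed
  then show "\<And>r x. r \<in> C \<Longrightarrow> (INF r\<in>C. r x) \<le> r x" by (simp add: m_def)
  have greatest: "b \<le> m x" if "\<And>r. r \<in> C \<Longrightarrow> b \<le> r x" for b x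
    unfolding m_def using ne that by (rule cINF_greatest)
  have "sublinear m"
    unfolding sublinear_def
  proof (intro conjI allI impI)
    fix x y
    have *: "m (x + y) \<le> r x + s y" if r: "r \<in> C" and s: "s \<in> C" for r s
    proof -
      obtain k where k: "k \<in> C" "k \<le> r" "k \<le> s"
        using total[OF r s] r s by blast
      have "m (x + y) \<le> k (x + y)" by (rule lower[OF k(1)])
      also have "\<dots> \<le> k x + k y" using C[OF k(1)] by (simp add: sublinear_add)
      also have "\<dots> \<le> r x + s y" using k by (intro add_mono) (auto simp: le_fun_def)
      finally show ?thesis .
    qed
    have "m (x + y) - r x \<le> m y" if "r \<in> C" for r
      by (rule greatest) (use *[OF that] in \<open>simp add: algebra_simps\<close>)
    then have "m (x + y) - m y \<le> m x"
      by (intro greatest) (simp add: algebra_simps)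
    then show "m (x + y) \<le> m x + m y" by simp
  next
    fix t :: real and x assume t: "0 \<le> t"
    have *: "m (t *\<^sub>R x) \<le> t * r x" if "r \<in> C" for r
      using lower[OF that, of "t *\<^sub>R x"] sublinear_scale_le[of r t x] C[OF that] t by force
    show "m (t *\<^sub>R x) \<le> t * m x"
    proof (cases "t = 0")
      case True
      then show ?thesis using * ne by auto
    next
      case False
      have "m (t *\<^sub>R x) / t \<le> m x"
        by (rule greatest) (use * False t in \<open>simp add: field_simps\<close>)
      then show ?thesis using False t by (simp add: field_simps)
    qed
  qed
  then show "sublinear (\<lambda>x. INF r\<in>C. r x)" by (simp add: m_def[abs_def])
qed

text \<open>
  Straightening along any \<open>y\<close> cannot lower a minimal functional, so the functional is already
  additive in every direction.
\<close>

lemma linear_if_minimal_sublinear: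
  assumes m: "sublinear m" and min: "\<And>r. sublinear r \<Longrightarrow> r \<le> m \<Longrightarrow> r = m"
  shows "linear m"
proof -
  have "straighten m y = m" for y
    by (intro min sublinear_straighten[OF m]) (simp add: le_fun_def straighten_le_self[OF m])
  then have "m x + m y \<le> m (x + y)" for x y
    using straighten_le[OF m, of 1 y x] by simp
  then have add: "m (x + y) = m x + m y" for x y
    using sublinear_add[OF m, of x y] by (intro antisym)
  have neg: "m (- x) = - m x" for x
    using add[of x "- x"] sublinear_zero[OF m] by simp
  have "m (t *\<^sub>R x) = t * m x" for t x
  proof (cases "0 \<le> t")
    case False
    then show ?thesis using sublinear_scale[OF m, of "- t" x] neg[of "t *\<^sub>R x"] by simp
  qed (rule sublinear_scale[OF m])
  with add show ?thesis by (intro linearI) simp_all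
qed

text \<open>
  By Zorn's lemma there is a minimal sublinear functional below \<open>straighten p x0\<close>. It is linear, and
  the start at \<open>straighten p x0\<close> instead of \<open>p\<close> forces its value at \<open>- x0\<close> down to \<open>- p x0\<close>.
\<close>

theorem Hahn_Banach_sublinear:
  fixes p :: "'v::real_vector \<Rightarrow> real"
  assumes p: "sublinear p"
  obtains l where "linear l" and "\<And>x. l x \<le> p x" and "l x0 = p x0"
proof -
  define p0 where "p0 = straighten p x0"
  have p0: "sublinear p0" unfolding p0_def by (rule sublinear_straighten[OF p])
  define S where "S = {r. sublinear r \<and> r \<le> p0}"
  have "\<exists>m\<in>S. \<forall>r\<in>S. m \<ge> r \<longrightarrow> r = m"
  proof (rule predicate_Zorn)
    show "partial_order_on S (relation_of (\<lambda>r s. r \<ge> s) S)"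
      by (rule partial_order_on_relation_ofI) auto
  next
    fix C assume "C \<in> Chains (relation_of (\<lambda>r s. r \<ge> s) S)"
    then have C: "C \<subseteq> S" and total: "\<And>r s. r \<in> C \<Longrightarrow> s \<in> C \<Longrightarrow> r \<le> s \<or> s \<le> r"
      by (auto simp: Chains_def relation_of_def)
    show "\<exists>u\<in>S. \<forall>r\<in>C. r \<ge> u"
    proof (cases "C = {}")
      case True
      then show ?thesis using p0 by (auto simp: S_def)
    next
      case False
      then obtain r0 where r0: "r0 \<in> C" by blast
      have inS: "sublinear r \<and> r \<le> p0" if "r \<in> C" for r
        using C that by (auto simp: S_def)
      note inf = sublinear_chain_INF[OF p0 False inS total]
      have "(\<lambda>x. INF r\<in>C. r x) \<le> r0"
        using inf(2) r0 by (auto simp: le_fun_def)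
      then have "(\<lambda>x. INF r\<in>C. r x) \<in> S"
        using inf(1) inS[OF r0] by (auto simp: S_def)
      then show ?thesis using inf(2) by (intro bexI) (auto simp: le_fun_def)
    qed
  qed
  then obtain m where m: "sublinear m" "m \<le> p0" and min: "\<And>r. sublinear r \<Longrightarrow> r \<le> p0 \<Longrightarrow> r \<le> m \<Longrightarrow> r = m"
    by (auto simp: S_def)
  have lin: "linear m"
    by (rule linear_if_minimal_sublinear[OF m(1)]) (use min m(2) in \<open>blast intro: order_trans\<close>)
  have le: "m x \<le> p x" for x
    using m(2) straighten_le_self[OF p, of x0 x] unfolding p0_def le_fun_def by (blast intro: order_trans)
  have "m (- x0) \<le> straighten p x0 (- x0)"
    using m(2) by (simp add: le_fun_def p0_def)
  also have "\<dots> \<le> - p x0"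
    using straighten_le[OF p, of 1 x0 "- x0"] sublinear_zero[OF p] by simp
  finally have "p x0 \<le> m x0"
    using linear_neg[OF lin, of x0] by simp
  with le[of x0] show thesis by (intro that[OF lin le]) simp
qed

text \<open>
  This carries real-linear functionals over to the scalar field.
  Over the complex numbers \<open>h x = l x - \<i> l (\<i> x)\<close> is the linear functional with real part \<open>l\<close>;
  over the reals \<open>h = l\<close>. The functional \<open>\<rho>\<close> is the real part on the abstract scalar field.
\<close>

lemma (in normed_scaling) real_part:
  obtains \<rho> :: "'k \<Rightarrow> real"
  where "\<And>r. \<rho> (of_real r) = r" and "\<And>c. \<rho> c \<le> norm c"
    and "\<And>l. linear l \<Longrightarrow> \<exists>h. (\<forall>x y. h (x + y) = h x + h y) \<and> (\<forall>c x. h (smul c x) = c * h x)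
              \<and> (\<forall>x. \<rho> (h x) = l x)"
proof -
  consider
    (R) \<phi> :: "'k \<Rightarrow> real" where "bij \<phi>" "\<And>x y. \<phi> (x + y) = \<phi> x + \<phi> y"
      "\<And>r x. \<phi> (r *\<^sub>R x) = r *\<^sub>R \<phi> x" "\<And>x y. \<phi> (x * y) = \<phi> x * \<phi> y" "\<And>x. norm (\<phi> x) = norm x"
  | (C) \<phi> :: "'k \<Rightarrow> complex" where "bij \<phi>" "\<And>x y. \<phi> (x + y) = \<phi> x + \<phi> y"
      "\<And>r x. \<phi> (r *\<^sub>R x) = r *\<^sub>R \<phi> x" "\<And>x y. \<phi> (x * y) = \<phi> x * \<phi> y" "\<And>x. norm (\<phi> x) = norm x"
    using iso_real_or_complex[where 'a = 'k] by blast
  then show thesis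
  proof cases
    case R
    have one: "\<phi> 1 = 1"
      using R(4)[of 1 1] R(5)[of 1] by auto
    have of_real: "\<phi> (of_real r) = r" for r
      using R(3)[of r 1] one by (simp add: of_real_def)
    have phi_eq: "c = of_real (\<phi> c)" for c
      using bij_is_inj[OF R(1)] of_real[of "\<phi> c"] by (simp add: inj_eq)
    show thesis
    proof (rule that[of \<phi>, OF of_real])
      show "\<phi> c \<le> norm c" for c using R(5)[of c] by simp
      fix l :: "'a \<Rightarrow> real" assume l: "linear l"
      have "smul c x = \<phi> c *\<^sub>R x" for c x
        using phi_eq[of c] smul_of_real[of "\<phi> c" x] by simp
      then have "of_real (l (smul c x)) = c * of_real (l x)" for c x
        using phi_eq[of c] by (metis linear_scale[OF l] of_real_mult real_scaleR_def)
      then show "\<exists>h. (\<forall>x y. h (x + y) = h x + h y) \<and> (\<forall>c x. h (smul c x) = c * h x)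
              \<and> (\<forall>x. \<phi> (h x) = l x)"
        by (intro exI[of _ "\<lambda>x. of_real (l x)"]) (simp add: of_real linear_add[OF l])
    qed
  next
    case C
    have one: "\<phi> 1 = 1"
      using C(4)[of 1 1] C(5)[of 1] by auto
    have of_real: "\<phi> (of_real r) = of_real r" for r
      using C(3)[of r 1] one by (simp add: of_real_def)
    obtain j where j: "\<phi> j = \<i>" using bij_is_surj[OF C(1)] by (metis surjD)
    have inj: "\<phi> x = \<phi> y \<longleftrightarrow> x = y" for x y using bij_is_inj[OF C(1)] by (simp add: inj_eq)
    have repr: "c = of_real (Re (\<phi> c)) + of_real (Im (\<phi> c)) * j" for c
      unfolding inj[symmetric] by (simp add: C(2,4) of_real j complex_eq_iff)
    have jj: "j * j = - 1"
    proof -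
      have "\<phi> (j * j) = \<phi> (of_real (- 1))" unfolding C(4) of_real j by simp
      then show ?thesis unfolding inj by simp
    qed
    show thesis
    proof (rule that[of "\<lambda>c. Re (\<phi> c)"])
      show "Re (\<phi> (of_real r)) = r" for r by (simp add: of_real)
      show "Re (\<phi> c) \<le> norm c" for c using C(5)[of c] complex_Re_le_cmod[of "\<phi> c"] by simp
      fix l :: "'a \<Rightarrow> real" assume l: "linear l"
      define h where "h x = of_real (l x) - of_real (l (smul j x)) * j" for x
      have add: "h (x + y) = h x + h y" for x y
        by (simp add: h_def scale_right_distrib linear_add[OF l] algebra_simps)
      have hr: "h (r *\<^sub>R x) = of_real r * h x" for r x
      proof -
        have "smul j (r *\<^sub>R x) = r *\<^sub>R smul j x"
          by (simp flip: smul_of_real add: mult.commute)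
        then show ?thesis by (simp add: h_def linear_scale[OF l] algebra_simps)
      qed
      have hj: "h (smul j x) = j * h x" for x
      proof -
        have "smul j (smul j x) = - x" by (simp add: jj scale_minus_left)
        then have "h (smul j x) = of_real (l (smul j x)) + of_real (l x) * j"
          by (simp add: h_def linear_neg[OF l])
        also have "\<dots> = j * of_real (l x) - of_real (l (smul j x)) * (j * j)"
          by (simp add: jj)
        also have "\<dots> = j * h x" by (simp add: h_def algebra_simps)
        finally show ?thesis .
      qed
      have "h (smul c x) = c * h x" for c x
      proof -
        have "smul c x = Re (\<phi> c) *\<^sub>R x + Im (\<phi> c) *\<^sub>R smul j x"
          by (subst repr[of c]) (simp add: scale_left_distrib smul_of_real flip: scale_scale)
        then have "h (smul c x) = (of_real (Re (\<phi> c)) + of_real (Im (\<phi> c)) * j) * h x"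
          by (simp add: add hr hj algebra_simps)
        then show ?thesis using repr[of c] by simp
      qed
      moreover have "Re (\<phi> (h x)) = l x" for x
      proof -
        have "h x = of_real (l x) + of_real (- l (smul j x)) * j" by (simp add: h_def)
        then show ?thesis by (simp only: C(2,4) of_real j) simp
      qed
      ultimately show "\<exists>h. (\<forall>x y. h (x + y) = h x + h y) \<and> (\<forall>c x. h (smul c x) = c * h x)
              \<and> (\<forall>x. Re (\<phi> (h x)) = l x)"
        using add by blast
    qed
  qed
qed

theorem (in normed_scaling) Hahn_Banach_seminorm:
  fixes N :: "'a \<Rightarrow> real"
  assumes add: "\<And>x y. N (x + y) \<le> N x + N y"
    and scale: "\<And>c x. N (smul c x) \<le> norm c * N x"
  obtains h :: "'a \<Rightarrow> 'k"
  where "\<And>x y. h (x + y) = h x + h y" and "\<And>c x. h (smul c x) = c * h x"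
    and "\<And>x. norm (h x) \<le> N x" and "N x0 \<le> norm (h x0)"
proof -
  have "sublinear N"
    unfolding sublinear_def using add scale[of "of_real t" for t]
    by (auto simp: smul_of_real) (metis abs_of_nonneg)
  then obtain l where l: "linear l" "\<And>x. l x \<le> N x" "l x0 = N x0"
    using Hahn_Banach_sublinear by blast
  obtain \<rho> :: "'k \<Rightarrow> real" where \<rho>: "\<And>r. \<rho> (of_real r) = r" "\<And>c. \<rho> c \<le> norm c"
    and ex: "\<And>l. linear l \<Longrightarrow> \<exists>h. (\<forall>x y. h (x + y) = h x + h y) \<and> (\<forall>c x. h (smul c x) = c * h x)
              \<and> (\<forall>x. \<rho> (h x) = l x)"
    using real_part by blast
  obtain h where h: "\<And>x y. h (x + y) = h x + h y" "\<And>c x. h (smul c x) = c * h x"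
    "\<And>x. \<rho> (h x) = l x"
    using ex[OF l(1)] by blast
  show thesis
  proof (rule that[OF h(1,2)])
    fix x
    show "norm (h x) \<le> N x"
    proof (cases "h x = 0")
      case True
      have "0 \<le> l x" using h(3)[of x] True \<rho>(1)[of 0] by simp
      with True l(2)[of x] show ?thesis by simp
    next
      case False
      \<comment> \<open>Rotating \<open>x\<close> makes \<open>h x\<close> a nonnegative real, which \<open>\<rho>\<close> sees in full.\<close>
      define u where "u = of_real (norm (h x)) / h x"
      have "norm u = 1" using False by (simp add: u_def norm_divide)
      have "norm (h x) = \<rho> (h (smul u x))"
        using False by (simp add: h(2) u_def \<rho>(1))
      also have "\<dots> \<le> N (smul u x)" using l(2) h(3) by simp
      also have "\<dots> \<le> N x" using scale[of u x] \<open>norm u = 1\<close> by simp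
      finally show ?thesis .
    qed
  next
    show "N x0 \<le> norm (h x0)" using \<rho>(2)[of "h x0"] h(3) l(3) by simp
  qed
qed

section \<open>Finite \<open>\<ell>\<^sup>p\<close> norms\<close>

definition fin_lp_norm :: "real \<Rightarrow> 'i set \<Rightarrow> ('i \<Rightarrow> 'b::real_normed_vector) \<Rightarrow> real" where
  "fin_lp_norm p A a = (\<Sum>n\<in>A. norm (a n) powr p) powr (1 / p)"

lemma fin_lp_norm_nonneg: "0 \<le> fin_lp_norm p A a"
  by (simp add: fin_lp_norm_def)

lemma fin_lp_norm_powr:
  "p \<noteq> 0 \<Longrightarrow> fin_lp_norm p A a powr p = (\<Sum>n\<in>A. norm (a n) powr p)"
  by (simp add: fin_lp_norm_def powr_powr sum_nonneg)

lemma fin_lp_norm_eq_0D: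
  assumes "finite A" "fin_lp_norm p A a = 0" "n \<in> A"
  shows "a n = 0"
  using assms by (auto simp: fin_lp_norm_def sum_nonneg_eq_0_iff)

lemma fin_lp_norm_mono:
  assumes "0 < p" "\<And>n. n \<in> A \<Longrightarrow> norm (a n) \<le> norm (b n)"
  shows "fin_lp_norm p A a \<le> fin_lp_norm p A b"
  unfolding fin_lp_norm_def using assms
  by (intro powr_mono2 sum_mono sum_nonneg) auto

lemma fin_lp_norm_scale:
  fixes c :: "'b::real_normed_field"
  assumes "0 < p"
  shows "fin_lp_norm p A (\<lambda>n. c * a n) = norm c * fin_lp_norm p A a"
  using assms
  by (simp add: fin_lp_norm_def norm_mult powr_mult sum_nonneg powr_powr flip: sum_distrib_left)

lemma fin_lp_norm_extend:
  assumes "finite B" "A \<subseteq> B" "0 < p"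
  shows "fin_lp_norm p B (\<lambda>n. if n \<in> A then a n else 0) = fin_lp_norm p A a"
proof -
  have "(\<Sum>n\<in>B. norm (if n \<in> A then a n else 0) powr p) = (\<Sum>n\<in>A. norm (a n) powr p)"
    using assms by (intro sum.mono_neutral_cong_right) auto
  then show ?thesis by (simp add: fin_lp_norm_def)
qed

locale conjugate_exponents =
  fixes p q :: real
  assumes p_gt_1: "1 < p" and q_gt_1: "1 < q" and conjugate: "1 / p + 1 / q = 1"
begin

text \<open>Young's inequality, summed after both sequences are normalised.\<close>

lemma Hoelder:
  assumes A: "finite A"
  shows "(\<Sum>n\<in>A. norm (a n) * norm (b n)) \<le> fin_lp_norm q A a * fin_lp_norm p A b"
proof (cases "fin_lp_norm q A a = 0 \<or> fin_lp_norm p A b = 0")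
  case True
  then have "norm (a n) * norm (b n) = 0" if "n \<in> A" for n
    using fin_lp_norm_eq_0D[OF A _ that, of q a] fin_lp_norm_eq_0D[OF A _ that, of p b] by auto
  then have "(\<Sum>n\<in>A. norm (a n) * norm (b n)) = 0" by (rule sum.neutral[OF ballI])
  then show ?thesis by (simp add: fin_lp_norm_nonneg)
next
  case False
  define \<alpha> \<beta> where "\<alpha> = fin_lp_norm q A a" and "\<beta> = fin_lp_norm p A b"
  have pos: "0 < \<alpha>" "0 < \<beta>"
    using False fin_lp_norm_nonneg[of q A a] fin_lp_norm_nonneg[of p A b]
    by (auto simp: \<alpha>_def \<beta>_def)
  have \<alpha>: "(\<Sum>n\<in>A. norm (a n) powr q) = \<alpha> powr q" and \<beta>: "(\<Sum>n\<in>A. norm (b n) powr p) = \<beta> powr p"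
    using p_gt_1 q_gt_1 by (simp_all add: \<alpha>_def \<beta>_def fin_lp_norm_powr)
  have "(\<Sum>n\<in>A. norm (a n) / \<alpha> * (norm (b n) / \<beta>))
      \<le> (\<Sum>n\<in>A. (norm (a n) / \<alpha>) powr q / q + (norm (b n) / \<beta>) powr p / p)"
    using p_gt_1 q_gt_1 conjugate pos by (intro sum_mono Youngs_inequality) auto
  also have "\<dots> = (\<Sum>n\<in>A. norm (a n) powr q) / \<alpha> powr q / q + (\<Sum>n\<in>A. norm (b n) powr p) / \<beta> powr p / p"
    using pos by (simp add: sum.distrib powr_divide sum_divide_distrib)
  also have "\<dots> = 1" using conjugate pos by (simp add: \<alpha> \<beta>)
  finally have "(\<Sum>n\<in>A. norm (a n) * norm (b n)) / (\<alpha> * \<beta>) \<le> 1"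
    by (simp add: sum_divide_distrib)
  then show ?thesis using pos by (simp add: \<alpha>_def \<beta>_def)
qed

text \<open>Equality in the inequality above is reached at the weights proportional to \<open>|a n|\<^bsup>q - 1\<^esup>\<close>.\<close>

lemma norming_weights:
  obtains w :: "'i \<Rightarrow> real"
  where "\<And>n. 0 \<le> w n" and "fin_lp_norm p A w \<le> 1"
    and "(\<Sum>n\<in>A. norm (a n) * w n) = fin_lp_norm q A a"
proof (cases "fin_lp_norm q A a = 0")
  case True
  then show ?thesis by (intro that[of "\<lambda>_. 0"]) (simp_all add: fin_lp_norm_def)
next
  case False
  define \<alpha> where "\<alpha> = fin_lp_norm q A a"
  have pos: "0 < \<alpha>" using False fin_lp_norm_nonneg[of q A a] by (simp add: \<alpha>_def)
  have \<alpha>: "(\<Sum>n\<in>A. norm (a n) powr q) = \<alpha> powr q"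
    using q_gt_1 by (simp add: \<alpha>_def fin_lp_norm_powr)
  have pq: "(q - 1) * p = q"
    using conjugate p_gt_1 q_gt_1 by (simp add: field_simps)
  define w where "w n = (norm (a n) / \<alpha>) powr (q - 1)" for n
  have "(\<Sum>n\<in>A. norm (w n) powr p) = (\<Sum>n\<in>A. norm (a n) powr q) / \<alpha> powr q"
    using pos by (simp add: w_def powr_powr pq powr_divide sum_divide_distrib)
  then have "fin_lp_norm p A w \<le> 1" using pos by (simp add: fin_lp_norm_def \<alpha>)
  moreover have "norm (a n) * w n = norm (a n) powr q / \<alpha> powr (q - 1)" for n
    using pos by (cases "a n = 0") (simp_all add: w_def powr_divide powr_mult_base)
  then have "(\<Sum>n\<in>A. norm (a n) * w n) = \<alpha> powr q / \<alpha> powr (q - 1)"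
    by (simp add: \<alpha> flip: sum_divide_distrib)
  then have "(\<Sum>n\<in>A. norm (a n) * w n) = \<alpha>"
    using pos by (simp flip: powr_diff)
  ultimately show thesis by (intro that[of w]) (simp_all add: w_def \<alpha>_def)
qed

text \<open>Against norming weights for \<open>a + b\<close> both summands are controlled by Hoelder's inequality.\<close>

lemma Minkowski:
  assumes A: "finite A"
  shows "fin_lp_norm q A (\<lambda>n. a n + b n) \<le> fin_lp_norm q A a + fin_lp_norm q A b"
proof -
  obtain w where w: "\<And>n. 0 \<le> w n" "fin_lp_norm p A w \<le> 1"
    "(\<Sum>n\<in>A. norm (a n + b n) * w n) = fin_lp_norm q A (\<lambda>n. a n + b n)"
    using norming_weights[of A "\<lambda>n. a n + b n"] by blast
  have *: "(\<Sum>n\<in>A. norm (c n) * w n) \<le> fin_lp_norm q A c" for c :: "_ \<Rightarrow> 'b"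
    using Hoelder[OF A, of c w] w(1) mult_left_mono[OF w(2) fin_lp_norm_nonneg[of q A c]] by simp
  have "fin_lp_norm q A (\<lambda>n. a n + b n) \<le> (\<Sum>n\<in>A. norm (a n) * w n + norm (b n) * w n)"
    unfolding w(3)[symmetric]
    by (intro sum_mono) (metis distrib_right mult_right_mono norm_triangle_ineq w(1))
  also have "\<dots> \<le> fin_lp_norm q A a + fin_lp_norm q A b"
    unfolding sum.distrib by (intro add_mono *)
  finally show ?thesis .
qed

text \<open>
  The converse of Hoelder's inequality: the norming weights for \<open>b\<close>, rotated by the phases of the
  \<open>b n\<close>, are admissible coefficients.
\<close>

lemma fin_lp_norm_le_1_if_pairing_bounded:
  fixes b :: "'i \<Rightarrow> 'k::real_normed_field"
  assumes bound: "\<And>c. norm (\<Sum>n\<in>A. c n * b n) \<le> fin_lp_norm q A c"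
  shows "fin_lp_norm p A b \<le> 1"
proof -
  interpret dual: conjugate_exponents q p
    using p_gt_1 q_gt_1 conjugate by unfold_locales simp_all
  obtain w where w: "\<And>n. 0 \<le> w n" "fin_lp_norm q A w \<le> 1"
    "(\<Sum>n\<in>A. norm (b n) * w n) = fin_lp_norm p A b"
    using dual.norming_weights[of A b] by blast
  \<comment> \<open>Where \<open>b n = 0\<close>, division by zero makes the coefficient \<open>0\<close>, so its norm is still at most \<open>w n\<close>.\<close>
  define c where "c n = of_real (w n) * (of_real (norm (b n)) / b n)" for n
  have "(\<Sum>n\<in>A. c n * b n) = of_real (\<Sum>n\<in>A. norm (b n) * w n)"
    unfolding of_real_sum by (rule sum.cong) (auto simp: c_def)
  then have "fin_lp_norm p A b = norm (\<Sum>n\<in>A. c n * b n)"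
    using fin_lp_norm_nonneg[of p A b] by (simp add: w(3))
  also have "\<dots> \<le> fin_lp_norm q A c" by (rule bound)
  also have "\<dots> \<le> fin_lp_norm q A w"
    using q_gt_1 w(1) by (intro fin_lp_norm_mono) (auto simp: c_def norm_mult norm_divide)
  also have "\<dots> \<le> 1" by (rule w(2))
  finally show ?thesis .
qed

end

text \<open>This reduces all work with the series, including its divergence, to finite sections.\<close>

lemma lp_norm_le_iff:
  assumes p: "0 < p" and C: "0 \<le> C"
  shows "lp_norm p a \<le> ennreal C \<longleftrightarrow> (\<forall>A. finite A \<longrightarrow> fin_lp_norm p A a \<le> C)"
proof -
  define s where "s = (\<Sum>n. ennreal (norm (a n) powr p))"
  have fin: "fin_lp_norm p A a \<le> C \<longleftrightarrow> (\<Sum>n\<in>A. norm (a n) powr p) \<le> C powr p" for A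
  proof
    assume "fin_lp_norm p A a \<le> C"
    then show "(\<Sum>n\<in>A. norm (a n) powr p) \<le> C powr p"
      using p powr_mono2[of p "fin_lp_norm p A a" C] by (simp add: fin_lp_norm_nonneg fin_lp_norm_powr)
  next
    assume "(\<Sum>n\<in>A. norm (a n) powr p) \<le> C powr p"
    then have "fin_lp_norm p A a \<le> (C powr p) powr (1 / p)"
      unfolding fin_lp_norm_def using p by (intro powr_mono2) (auto intro: sum_nonneg)
    then show "fin_lp_norm p A a \<le> C" using p C by (simp add: powr_powr)
  qed
  have s_le: "s \<le> ennreal (C powr p) \<longleftrightarrow> (\<forall>A. finite A \<longrightarrow> fin_lp_norm p A a \<le> C)"
  proof
    assume s: "s \<le> ennreal (C powr p)"
    show "\<forall>A. finite A \<longrightarrow> fin_lp_norm p A a \<le> C"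
    proof (intro allI impI)
      fix A :: "nat set" assume "finite A"
      then have "(\<Sum>n\<in>A. ennreal (norm (a n) powr p)) \<le> s"
        unfolding s_def by (intro sum_le_suminf) auto
      then have "ennreal (\<Sum>n\<in>A. norm (a n) powr p) \<le> ennreal (C powr p)"
        using s by (simp add: sum_ennreal del: ennreal_le_iff)
      then show "fin_lp_norm p A a \<le> C" unfolding fin by (subst (asm) ennreal_le_iff) simp_all
    qed
  next
    assume *: "\<forall>A. finite A \<longrightarrow> fin_lp_norm p A a \<le> C"
    show "s \<le> ennreal (C powr p)"
      unfolding s_def
    proof (rule suminf_le_const)
      fix n
      show "(\<Sum>i<n. ennreal (norm (a i) powr p)) \<le> ennreal (C powr p)"
        using * fin[of "{..<n}"] by (simp add: sum_ennreal ennreal_leI)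
    qed simp
  qed
  have "lp_norm p a \<le> ennreal C \<longleftrightarrow> s \<le> ennreal (C powr p)"
  proof (cases "s = \<infinity>")
    case True
    then show ?thesis by (simp add: lp_norm_def Let_def top_unique flip: s_def)
  next
    case False
    then obtain r where r: "s = ennreal r" "0 \<le> r" by (cases s) auto
    have "r powr (1 / p) \<le> C \<longleftrightarrow> r \<le> C powr p"
      using p C r(2) powr_mono2[of p "r powr (1 / p)" C] powr_mono2[of "1 / p" r "C powr p"]
      by (auto simp: powr_powr)
    then show ?thesis
      using r C by (simp add: lp_norm_def Let_def ennreal_le_iff flip: s_def)
  qed
  with s_le show ?thesis by simp
qed

section \<open>The cost of approximating by combinations of a sequence\<close>

lemma dual_space_sum_smul:
  assumes "h \<in> dual_space smul"
  shows "h (\<Sum>n\<in>A. smul (a n) (f n)) = (\<Sum>n\<in>A. a n * h (f n))"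
  using assms by (simp add: blinfun.sum_right dual_space_def)

lemma (in normed_scaling) in_dual_spaceI:
  fixes h :: "'a \<Rightarrow> 'k"
  assumes add: "\<And>x y. h (x + y) = h x + h y" and scale: "\<And>c x. h (smul c x) = c * h x"
    and bound: "\<And>x. norm (h x) \<le> norm x * B"
  obtains H where "H \<in> dual_space smul" and "blinfun_apply H = h"
proof -
  have "bounded_linear h"
  proof (rule bounded_linear_intro[OF add _ bound])
    fix r x show "h (r *\<^sub>R x) = r *\<^sub>R h x"
      using scale[of "of_real r" x] by (simp add: smul_of_real scaleR_conv_of_real)
  qed
  then have "blinfun_apply (Blinfun h) = h" by (rule bounded_linear_Blinfun_apply)
  with scale show thesis by (intro that[of "Blinfun h"]) (simp_all add: dual_space_def)
qed

text \<open>
  The gauge whose value at \<open>y\<close> is the least cost of describing \<open>y\<close> by a combination of the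
  \<open>f n\<close>, where coefficients cost their \<open>\<ell>\<^sup>q\<close> norm and the error is charged at the rate \<open>1 / d\<close>.
\<close>

definition approx_cost ::
    "('k::real_or_complex \<Rightarrow> 'a::real_normed_vector \<Rightarrow> 'a) \<Rightarrow> real \<Rightarrow> (nat \<Rightarrow> 'a) \<Rightarrow> real \<Rightarrow> 'a \<Rightarrow> real" where
  "approx_cost smul q f d y =
     (INF (A, a)\<in>{(A, a). finite A}.
        fin_lp_norm q A a + norm (y - (\<Sum>n\<in>A. smul (a n) (f n))) / d)"

lemma approx_cost_le:
  assumes "0 < d" "finite A"
  shows "approx_cost smul q f d y \<le> fin_lp_norm q A a + norm (y - (\<Sum>n\<in>A. smul (a n) (f n))) / d"
  unfolding approx_cost_def
proof (rule cINF_lower2)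
  show "bdd_below ((\<lambda>(A, a). fin_lp_norm q A a + norm (y - (\<Sum>n\<in>A. smul (a n) (f n))) / d) ` {(A, a). finite A})"
    using assms(1) by (intro bdd_belowI2[of _ 0]) (auto simp: fin_lp_norm_nonneg)
  show "(A, a) \<in> {(A, a). finite A}" using assms(2) by simp
qed simp

lemma approx_cost_less:
  assumes "approx_cost smul q f d y < C"
  obtains A a where "finite A"
    and "fin_lp_norm q A a + norm (y - (\<Sum>n\<in>A. smul (a n) (f n))) / d < C"
proof -
  have "{(A, a :: nat \<Rightarrow> 'a). finite A} \<noteq> {}" by blast
  from cInf_lessD[OF _ assms[unfolded approx_cost_def]] that show thesis by auto
qed

text \<open>
  Near-optimal combinations for \<open>x\<close> and \<open>y\<close>, extended by zero to a common index set, add up to a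
  combination for \<open>x + y\<close>, and their coefficient norms add up by Minkowski's inequality.
\<close>

lemma (in normed_scaling) approx_cost_add:
  assumes d: "0 < d" and pq: "conjugate_exponents p q"
  shows "approx_cost smul q f d (x + y) \<le> approx_cost smul q f d x + approx_cost smul q f d y"
proof (rule field_le_epsilon)
  interpret conjugate_exponents p q by (rule pq)
  fix e :: real assume e: "0 < e"
  obtain A a where A: "finite A"
    and a: "fin_lp_norm q A a + norm (x - (\<Sum>n\<in>A. smul (a n) (f n))) / d < approx_cost smul q f d x + e / 2"
    using e by (rule_tac approx_cost_less[of smul q f d x "approx_cost smul q f d x + e / 2"]) auto
  obtain B b where B: "finite B"
    and b: "fin_lp_norm q B b + norm (y - (\<Sum>n\<in>B. smul (b n) (f n))) / d < approx_cost smul q f d y + e / 2"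
    using e by (rule_tac approx_cost_less[of smul q f d y "approx_cost smul q f d y + e / 2"]) auto
  define a' b' where "a' n = (if n \<in> A then a n else 0)" and "b' n = (if n \<in> B then b n else 0)" for n
  have fin: "finite (A \<union> B)" using A B by simp
  have na: "fin_lp_norm q (A \<union> B) a' = fin_lp_norm q A a"
    and nb: "fin_lp_norm q (A \<union> B) b' = fin_lp_norm q B b"
    unfolding a'_def[abs_def] b'_def[abs_def] using fin q_gt_1 by (auto intro: fin_lp_norm_extend)
  have sa: "(\<Sum>n\<in>A \<union> B. smul (a' n) (f n)) = (\<Sum>n\<in>A. smul (a n) (f n))"
    and sb: "(\<Sum>n\<in>A \<union> B. smul (b' n) (f n)) = (\<Sum>n\<in>B. smul (b n) (f n))"
    using fin by (auto intro!: sum.mono_neutral_cong_right simp: a'_def b'_def)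
  have "x + y - (\<Sum>n\<in>A \<union> B. smul (a' n + b' n) (f n))
      = (x - (\<Sum>n\<in>A. smul (a n) (f n))) + (y - (\<Sum>n\<in>B. smul (b n) (f n)))"
    unfolding scale_left_distrib sum.distrib sa sb by simp
  then have "norm (x + y - (\<Sum>n\<in>A \<union> B. smul (a' n + b' n) (f n)))
      \<le> norm (x - (\<Sum>n\<in>A. smul (a n) (f n))) + norm (y - (\<Sum>n\<in>B. smul (b n) (f n)))"
    by (metis norm_triangle_ineq)
  then have "norm (x + y - (\<Sum>n\<in>A \<union> B. smul (a' n + b' n) (f n))) / d
      \<le> norm (x - (\<Sum>n\<in>A. smul (a n) (f n))) / d + norm (y - (\<Sum>n\<in>B. smul (b n) (f n))) / d"
    using d by (simp add: divide_right_mono flip: add_divide_distrib)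
  with approx_cost_le[OF d fin, of smul q f "x + y" "\<lambda>n. a' n + b' n"] Minkowski[OF fin, of a' b'] a b
  show "approx_cost smul q f d (x + y) \<le> approx_cost smul q f d x + approx_cost smul q f d y + e"
    unfolding na nb by simp
qed

lemma (in normed_scaling) approx_cost_scale:
  assumes d: "0 < d" and q: "0 < q"
  shows "approx_cost smul q f d (smul c x) \<le> norm c * approx_cost smul q f d x"
proof -
  have *: "approx_cost smul q f d (smul c x)
      \<le> norm c * (fin_lp_norm q A a + norm (x - (\<Sum>n\<in>A. smul (a n) (f n))) / d)"
    if A: "finite A" for A a
  proof -
    have "smul c x - (\<Sum>n\<in>A. smul (c * a n) (f n)) = smul c (x - (\<Sum>n\<in>A. smul (a n) (f n)))"
      by (simp add: scale_right_diff_distrib scale_sum_right)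
    then show ?thesis
      using approx_cost_le[OF d A, of smul q f "smul c x" "\<lambda>n. c * a n"]
      by (simp add: norm_smul fin_lp_norm_scale[OF q] distrib_left)
  qed
  show ?thesis
  proof (cases "c = 0")
    case True
    then show ?thesis using *[of "{}"] by simp
  next
    case False
    show ?thesis
    proof (rule ccontr)
      assume "\<not> ?thesis"
      with False have "approx_cost smul q f d x < approx_cost smul q f d (smul c x) / norm c"
        by (simp add: field_simps)
      then obtain A a where "finite A"
        "fin_lp_norm q A a + norm (x - (\<Sum>n\<in>A. smul (a n) (f n))) / d
          < approx_cost smul q f d (smul c x) / norm c"
        by (rule approx_cost_less)
      with *[of A a] False show False by (simp add: field_simps)
    qed
  qed
qed

text \<open>
  A norming functional of the gauge at \<open>x\<close> lies below the gauge. At combinations of the \<open>f n\<close> this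
  bounds the \<open>\<ell>\<^sup>p\<close> norm of its values by \<open>1\<close>, so the lower bound in the hypothesis gives norm at
  most \<open>K\<close>.
\<close>

lemma (in normed_scaling) approx_cost_le_norm:
  assumes pq: "conjugate_exponents p q" and K: "0 < K" and d: "0 < d"
    and lower: "\<forall>h\<in>dual_space smul. ennreal (1 / K * norm h) \<le> lp_norm p (\<lambda>n. blinfun_apply h (f n))"
  shows "approx_cost smul q f d x \<le> K * norm x"
proof -
  interpret conjugate_exponents p q by (rule pq)
  let ?N = "approx_cost smul q f d"
  obtain h :: "'a \<Rightarrow> 'k" where h: "\<And>x y. h (x + y) = h x + h y" "\<And>c x. h (smul c x) = c * h x"
    "\<And>y. norm (h y) \<le> ?N y" "?N x \<le> norm (h x)"
    using Hahn_Banach_seminorm[of ?N x] approx_cost_add[OF d pq] approx_cost_scale[OF d] q_gt_1 by force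
  have "norm (h y) \<le> norm y * (1 / d)" for y
    using h(3)[of y] approx_cost_le[OF d finite.emptyI, of smul q f y] by (simp add: fin_lp_norm_def)
  then obtain H where H: "H \<in> dual_space smul" "blinfun_apply H = h"
    using in_dual_spaceI[OF h(1,2)] by blast
  have "fin_lp_norm p A (\<lambda>n. H (f n)) \<le> 1" if A: "finite A" for A
  proof (rule fin_lp_norm_le_1_if_pairing_bounded)
    fix c
    have "norm (\<Sum>n\<in>A. c n * H (f n)) \<le> ?N (\<Sum>n\<in>A. smul (c n) (f n))"
      using h(3)[of "\<Sum>n\<in>A. smul (c n) (f n)"] dual_space_sum_smul[OF H(1), of c f A] H(2) by simp
    also have "\<dots> \<le> fin_lp_norm q A c"
      using approx_cost_le[OF d A, of smul q f "\<Sum>n\<in>A. smul (c n) (f n)" c] by simp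
    finally show "norm (\<Sum>n\<in>A. c n * H (f n)) \<le> fin_lp_norm q A c" .
  qed
  then have "lp_norm p (\<lambda>n. H (f n)) \<le> ennreal 1"
    using p_gt_1 by (subst lp_norm_le_iff) auto
  with lower H(1) have "ennreal (1 / K * norm H) \<le> ennreal 1" by (blast intro: order_trans)
  then have "norm H \<le> K" using K by (simp add: ennreal_le_iff field_simps del: ennreal_1)
  then have "norm (h x) \<le> K * norm x"
    using norm_blinfun[of H x] H(2) mult_right_mono[of "norm H" K "norm x"] by simp
  with h(4) show ?thesis by simp
qed

section \<open>Systems and lower bounds for functionals\<close>

text \<open>
  The gauge only yields coefficients of norm slightly above \<open>K * norm x\<close>. The slack is removed by
  approximating \<open>t *\<^sub>R x\<close> with \<open>t < 1\<close> close to \<open>1\<close> in place of \<open>x\<close>.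
\<close>

lemma (in normed_scaling) Cq_system_if_lower_bound:
  assumes pq: "conjugate_exponents p q" and K: "0 < K"
    and lower: "\<forall>h\<in>dual_space smul. ennreal (1 / K * norm h) \<le> lp_norm p (\<lambda>n. blinfun_apply h (f n))"
  shows "Cq_system smul q K f"
  unfolding Cq_system_def fin_lp_norm_def[symmetric]
proof (intro allI impI)
  fix x :: 'a and e :: real assume e: "0 < e"
  show "\<exists>(A :: nat set) (a :: nat \<Rightarrow> 'k). finite A \<and> norm (x - (\<Sum>n\<in>A. smul (a n) (f n))) < e
      \<and> fin_lp_norm q A a \<le> K * norm x"
  proof (cases "x = 0")
    case True
    then show ?thesis using e by (intro exI[of _ "{}"]) (simp add: fin_lp_norm_def)
  next
    case False
    then have x: "0 < norm x" by simp
    define s where "s = min 1 (e / (2 * norm x))"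
    have s: "0 < s" "s \<le> 1" "s * norm x \<le> e / 2"
      using e x by (auto simp: s_def min_def field_simps)
    define d where "d = e / (2 * K * norm x)"
    have d: "0 < d" using e x K by (simp add: d_def)
    have "approx_cost smul q f d ((1 - s) *\<^sub>R x) \<le> K * ((1 - s) * norm x)"
      using approx_cost_le_norm[OF pq K d lower, of "(1 - s) *\<^sub>R x"] s by simp
    also have "\<dots> < K * norm x" using K x s by simp
    finally obtain A a where A: "finite A"
      and a: "fin_lp_norm q A a + norm ((1 - s) *\<^sub>R x - (\<Sum>n\<in>A. smul (a n) (f n))) / d < K * norm x"
      by (rule approx_cost_less)
    let ?g = "\<Sum>n\<in>A. smul (a n) (f n)"
    have "0 \<le> norm ((1 - s) *\<^sub>R x - ?g) / d" using d by simp
    with a have coeffs: "fin_lp_norm q A a \<le> K * norm x" by linarith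
    have "norm ((1 - s) *\<^sub>R x - ?g) / d < K * norm x"
      using a fin_lp_norm_nonneg[of q A a] by linarith
    then have "norm ((1 - s) *\<^sub>R x - ?g) < K * norm x * d"
      using d by (simp add: field_simps)
    also have "\<dots> = e / 2" using K x by (simp add: d_def)
    finally have "norm ((1 - s) *\<^sub>R x - ?g) < e / 2" .
    moreover have "x - ?g = s *\<^sub>R x + ((1 - s) *\<^sub>R x - ?g)" by (simp add: algebra_simps)
    then have "norm (x - ?g) \<le> norm (s *\<^sub>R x) + norm ((1 - s) *\<^sub>R x - ?g)"
      by (metis norm_triangle_ineq)
    ultimately have "norm (x - ?g) < e" using s by simp
    with A coeffs show ?thesis by blast
  qed
qed

text \<open>
  When the series diverges the bound is trivial; otherwise Hoelder's inequality bounds \<open>h\<close> at the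
  approximants, and continuity carries the bound over to the approximated point.
\<close>

lemma lower_bound_if_Cq_system:
  assumes pq: "conjugate_exponents p q" and K: "0 < K" and sys: "Cq_system smul q K f"
    and h: "h \<in> dual_space smul"
  shows "ennreal (1 / K * norm h) \<le> lp_norm p (\<lambda>n. blinfun_apply h (f n))"
proof (cases "lp_norm p (\<lambda>n. blinfun_apply h (f n))")
  case (real L)
  interpret conjugate_exponents p q by (rule pq)
  have L: "fin_lp_norm p A (\<lambda>n. h (f n)) \<le> L" if "finite A" for A
    using lp_norm_le_iff[of p L "\<lambda>n. h (f n)"] real p_gt_1 that by simp
  have "norm (h x) \<le> K * L * norm x" for x
  proof (rule field_le_epsilon)
    fix e :: real assume e: "0 < e"
    \<comment> \<open>The shift by \<open>1\<close> keeps the tolerance positive when \<open>h\<close> vanishes.\<close>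
    define \<epsilon> where "\<epsilon> = e / (norm h + 1)"
    have h1: "0 < norm h + 1" by (simp add: add_nonneg_pos)
    have "0 < \<epsilon>" using e h1 by (simp add: \<epsilon>_def)
    with sys obtain A a where A: "finite A" and near: "norm (x - (\<Sum>n\<in>A. smul (a n) (f n))) < \<epsilon>"
      and coeffs: "fin_lp_norm q A a \<le> K * norm x"
      unfolding Cq_system_def fin_lp_norm_def by blast
    let ?g = "\<Sum>n\<in>A. smul (a n) (f n)"
    have "norm (h ?g) \<le> (\<Sum>n\<in>A. norm (a n) * norm (h (f n)))"
      unfolding dual_space_sum_smul[OF h] norm_mult[symmetric] by (rule norm_sum)
    also have "\<dots> \<le> fin_lp_norm q A a * fin_lp_norm p A (\<lambda>n. h (f n))" by (rule Hoelder[OF A])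
    also have "\<dots> \<le> K * norm x * L"
      using coeffs L[OF A] K by (intro mult_mono) (auto simp: fin_lp_norm_nonneg)
    finally have g: "norm (h ?g) \<le> K * norm x * L" .
    have "norm (h (x - ?g)) \<le> norm h * \<epsilon>"
      using norm_blinfun[of h "x - ?g"] mult_left_mono[of "norm (x - ?g)" \<epsilon> "norm h"] near by simp
    also have "\<dots> \<le> e" using h1 e by (simp add: \<epsilon>_def field_simps)
    finally have "norm (h (x - ?g)) \<le> e" .
    moreover have "norm (h x) \<le> norm (h ?g) + norm (h (x - ?g))"
      using norm_triangle_ineq[of "h ?g" "h (x - ?g)"] by (simp add: blinfun.diff_right)
    ultimately show "norm (h x) \<le> K * L * norm x + e" using g by (simp add: algebra_simps)
  qed
  then have "norm h \<le> K * L" using K real by (intro norm_blinfun_bound) auto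
  then show ?thesis using K real by (simp add: ennreal_le_iff field_simps)
qed simp

theorem lemma3p3:
  fixes smul :: "'k::real_or_complex \<Rightarrow> 'a::banach \<Rightarrow> 'a"
    and f :: "nat \<Rightarrow> 'a" and p q K :: real
  assumes "normed_scaling smul"
    and "separable_space (euclidean :: 'a topology)"
    and "reflexive_space smul"
    and "1 < p" and "1 < q" and "1 / p + 1 / q = 1"
    and "K > 0"
  shows "Cq_system smul q K f \<longleftrightarrow>
    (\<forall>h\<in>dual_space smul. ennreal (1 / K * norm h) \<le> lp_norm p (\<lambda>n. blinfun_apply h (f n)))"
proof -
  interpret normed_scaling smul by (rule assms)
  have pq: "conjugate_exponents p q" using assms by (simp add: conjugate_exponents_def)
  show ?thesis
    using lower_bound_if_Cq_system[OF pq \<open>K > 0\<close>] Cq_system_if_lower_bound[OF pq \<open>K > 0\<close>] by blast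
qed

end
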